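(* There is no conjugation $C$ on $H^2$ such that $C(\mathcal{M}(S))=\mathcal{M}(S^* )$, i.e. such that $\{C(M): M\in\mathcal{M}(S)\}=\mathcal{M}(S^* )$.
   Context: $H^2$ is the Hardy–Hilbert space of the unit disk, with shift $S:H^2\to H^2$, $(Sf)(z)=zf(z)$, and adjoint $S^*$. A conjugation on a complex Hilbert space $\mathcal{H}$ is an antilinear map $C:\mathcal{H}\to\mathcal{H}$ such that $\langle Cf, Cg\rangle = \langle g,f\rangle$ and $C^2h=h$ for all $f,g,h\in\mathcal{H}$. $\mathcal{M}(S)$ is the collection of all closed $S$-invariant subspaces $M$ of $H^2$ with $\dim M=\infty=\dim M^\perp$; equivalently, $\mathcal{M}(S)=\{\theta H^2:\theta \text{ is an inner function that is not a finite Blaschke product}\}$ (unimodular constants being counted as finite Blaschke products). $\mathcal{M}(S^* )=\{M^\perp: M\in\mathcal{M}(S)\}$, i.e. the collection of all model spaces $K_\theta=H^2\ominus\theta H^2$, $\theta$ inner, with $\dim K_\theta=\infty$. *)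

theory Defs
  imports "HOL-Complex_Analysis.Complex_Analysis"
begin

section \<open>The Hardy--Hilbert space of the unit disk\<close>

text \<open>
  Elements of \<open>H\<^sup>2\<close> are the holomorphic functions on the open unit disk whose Taylor
  coefficients at 0 are square-summable.  Functions in HOL are total, so the value outside the
  disk is fixed to be 0; this makes equality in the type agree with equality on the disk.
\<close>

definition square_summable_fps :: "complex fps \<Rightarrow> bool" where
  "square_summable_fps F \<longleftrightarrow> summable (\<lambda>n. (cmod (fps_nth F n))\<^sup>2)"

definition hardy_set :: "(complex \<Rightarrow> complex) set" where
  "hardy_set = {f. f holomorphic_on ball 0 1 \<and> (\<forall>z. z \<notin> ball 0 1 \<longrightarrow> f z = 0) \<and>
                   square_summable_fps (fps_expansion f 0)}"

lemma hardy_set_has_fps_expansion: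
  "f \<in> hardy_set \<Longrightarrow> f has_fps_expansion fps_expansion f 0"
  by (rule has_fps_expansion_fps_expansion[of "ball 0 1"]) (auto simp: hardy_set_def)

lemma hardy_setI:
  assumes "f holomorphic_on ball 0 1" "\<And>z. z \<notin> ball 0 1 \<Longrightarrow> f z = 0"
    and "f has_fps_expansion F" "square_summable_fps F"
  shows "f \<in> hardy_set"
  using assms fps_expansion_eqI[of f F] by (auto simp: hardy_set_def)

lemma square_summable_fps_add:
  assumes "square_summable_fps F" "square_summable_fps G"
  shows "square_summable_fps (F + G)"
  unfolding square_summable_fps_def
proof (rule summable_comparison_test')
  show "summable (\<lambda>n. 2 * (cmod (fps_nth F n))\<^sup>2 + 2 * (cmod (fps_nth G n))\<^sup>2)"
    using assms by (intro summable_add summable_mult) (auto simp: square_summable_fps_def)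
next
  fix n :: nat
  let ?a = "cmod (fps_nth F n)" and ?b = "cmod (fps_nth G n)"
  have "(cmod (fps_nth (F + G) n))\<^sup>2 \<le> (?a + ?b)\<^sup>2"
    by (intro power_mono) (auto intro: norm_triangle_ineq)
  also have "\<dots> \<le> 2 * ?a\<^sup>2 + 2 * ?b\<^sup>2"
    using zero_le_power2[of "?a - ?b"] by (simp add: power2_eq_square algebra_simps)
  finally show "norm ((cmod (fps_nth (F + G) n))\<^sup>2) \<le> 2 * ?a\<^sup>2 + 2 * ?b\<^sup>2"
    by simp
qed

lemma square_summable_fps_cmult:
  assumes "square_summable_fps F"
  shows "square_summable_fps (fps_const c * F)"
  using assms summable_mult[of _ "(cmod c)\<^sup>2"]
  by (auto simp: square_summable_fps_def norm_mult power_mult_distrib)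

lemma square_summable_fps_X:
  assumes "square_summable_fps F"
  shows "square_summable_fps (fps_X * F)"
  unfolding square_summable_fps_def
  by (subst summable_Suc_iff[symmetric]) (use assms in \<open>simp add: square_summable_fps_def\<close>)

lemma hardy_set_zero: "(\<lambda>z. 0) \<in> hardy_set"
  by (rule hardy_setI[where F = 0]) (auto simp: square_summable_fps_def)

lemma hardy_set_add:
  assumes "f \<in> hardy_set" "g \<in> hardy_set"
  shows "(\<lambda>z. f z + g z) \<in> hardy_set"
  using assms hardy_set_has_fps_expansion[OF assms(1)] hardy_set_has_fps_expansion[OF assms(2)]
  by (intro hardy_setI[where F = "fps_expansion f 0 + fps_expansion g 0"])
     (auto simp: hardy_set_def intro!: holomorphic_intros fps_expansion_intros square_summable_fps_add)

lemma hardy_set_cmult: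
  assumes "f \<in> hardy_set"
  shows "(\<lambda>z. c * f z) \<in> hardy_set"
  using assms hardy_set_has_fps_expansion[OF assms]
  by (intro hardy_setI[where F = "fps_const c * fps_expansion f 0"])
     (auto simp: hardy_set_def intro!: holomorphic_intros fps_expansion_intros square_summable_fps_cmult)

lemma hardy_set_shift:
  assumes "f \<in> hardy_set"
  shows "(\<lambda>z. z * f z) \<in> hardy_set"
  using assms hardy_set_has_fps_expansion[OF assms]
  by (intro hardy_setI[where F = "fps_X * fps_expansion f 0"])
     (auto simp: hardy_set_def intro!: holomorphic_intros fps_expansion_intros square_summable_fps_X)

typedef hardy = hardy_set
  morphisms hardy_fun Abs_hardy
  using hardy_set_zero by blast

setup_lifting type_definition_hardy

definition hardy_coeff :: "hardy \<Rightarrow> nat \<Rightarrow> complex" where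
  "hardy_coeff f n = fps_nth (fps_expansion (hardy_fun f) 0) n"

lift_definition hscale :: "complex \<Rightarrow> hardy \<Rightarrow> hardy" is "\<lambda>c f z. c * f z"
  by (rule hardy_set_cmult)

lift_definition shift :: "hardy \<Rightarrow> hardy" is "\<lambda>f z. z * f z"
  by (rule hardy_set_shift)

instantiation hardy :: ab_group_add
begin

lift_definition zero_hardy :: hardy is "\<lambda>z. 0"
  by (rule hardy_set_zero)

lift_definition plus_hardy :: "hardy \<Rightarrow> hardy \<Rightarrow> hardy" is "\<lambda>f g z. f z + g z"
  by (rule hardy_set_add)

lift_definition uminus_hardy :: "hardy \<Rightarrow> hardy" is "\<lambda>f z. - f z"
  using hardy_set_cmult[of _ "-1"] by simp

lift_definition minus_hardy :: "hardy \<Rightarrow> hardy \<Rightarrow> hardy" is "\<lambda>f g z. f z - g z"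
  using hardy_set_add[OF _ hardy_set_cmult[of _ "-1"]] by simp

instance
  by standard (transfer; simp add: algebra_simps fun_eq_iff)+

end

global_interpretation hardy: vector_space hscale
  defines hspan = hardy.span and hsubspace = hardy.subspace
  by standard (transfer; simp add: algebra_simps fun_eq_iff)+

definition hinner :: "hardy \<Rightarrow> hardy \<Rightarrow> complex" where
  "hinner f g = (\<Sum>n. hardy_coeff f n * cnj (hardy_coeff g n))"

lemma hardy_fun_has_fps_expansion:
  "hardy_fun f has_fps_expansion fps_expansion (hardy_fun f) 0"
  using hardy_fun[of f] by (rule hardy_set_has_fps_expansion)

lemma hardy_coeff_eqI:
  "hardy_fun f has_fps_expansion F \<Longrightarrow> hardy_coeff f n = fps_nth F n"
  by (simp add: hardy_coeff_def fps_expansion_eqI)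

lemma hardy_coeff_zero [simp]: "hardy_coeff 0 n = 0"
  by (subst hardy_coeff_eqI[where F = 0]) (auto simp: zero_hardy.rep_eq)

lemma hardy_coeff_add [simp]: "hardy_coeff (f + g) n = hardy_coeff f n + hardy_coeff g n"
proof -
  have "hardy_fun (f + g) has_fps_expansion
          fps_expansion (hardy_fun f) 0 + fps_expansion (hardy_fun g) 0"
    unfolding plus_hardy.rep_eq
    by (intro fps_expansion_intros hardy_fun_has_fps_expansion)
  from hardy_coeff_eqI[OF this] show ?thesis by (simp add: hardy_coeff_def)
qed

lemma hardy_coeff_hscale [simp]: "hardy_coeff (hscale c f) n = c * hardy_coeff f n"
proof -
  have "hardy_fun (hscale c f) has_fps_expansion fps_const c * fps_expansion (hardy_fun f) 0"
    unfolding hscale.rep_eq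
    by (intro fps_expansion_intros hardy_fun_has_fps_expansion)
  from hardy_coeff_eqI[OF this] show ?thesis by (simp add: hardy_coeff_def)
qed

lemma hardy_coeff_shift:
  "hardy_coeff (shift f) n = (if n = 0 then 0 else hardy_coeff f (n - 1))"
proof -
  have "hardy_fun (shift f) has_fps_expansion fps_X * fps_expansion (hardy_fun f) 0"
    unfolding shift.rep_eq
    by (intro fps_expansion_intros hardy_fun_has_fps_expansion)
  from hardy_coeff_eqI[OF this] show ?thesis by (simp add: hardy_coeff_def)
qed

lemma hardy_coeff_square_summable: "summable (\<lambda>n. (cmod (hardy_coeff f n))\<^sup>2)"
  using hardy_fun[of f] by (simp add: hardy_set_def square_summable_fps_def hardy_coeff_def)

lemma hardy_eq_zeroI:
  assumes "\<And>n. hardy_coeff f n = 0"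
  shows "f = 0"
proof -
  have F: "fps_expansion (hardy_fun f) 0 = 0"
    using assms by (simp add: fps_eq_iff hardy_coeff_def)
  have "hardy_fun f z = 0" for z
  proof (cases "z \<in> ball 0 1")
    case True
    have "eval_fps 0 z = hardy_fun f z"
      using True hardy_fun_has_fps_expansion[of f] hardy_fun[of f]
      by (intro has_fps_expansion_imp_eval_fps_eq[where r = 1]) (auto simp: F hardy_set_def)
    thus ?thesis by simp
  next
    case False
    thus ?thesis using hardy_fun[of f] by (auto simp: hardy_set_def)
  qed
  thus ?thesis by transfer (simp add: fun_eq_iff)
qed

lemma hinner_summable: "summable (\<lambda>n. hardy_coeff f n * cnj (hardy_coeff g n))"
proof (rule summable_comparison_test')
  show "summable (\<lambda>n. (cmod (hardy_coeff f n))\<^sup>2 + (cmod (hardy_coeff g n))\<^sup>2)"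
    by (intro summable_add hardy_coeff_square_summable)
next
  fix n :: nat
  let ?a = "cmod (hardy_coeff f n)" and ?b = "cmod (hardy_coeff g n)"
  have "2 * (?a * ?b) \<le> ?a\<^sup>2 + ?b\<^sup>2"
    using zero_le_power2[of "?a - ?b"] by (simp add: power2_eq_square algebra_simps)
  moreover have "0 \<le> ?a * ?b" by simp
  ultimately have "?a * ?b \<le> ?a\<^sup>2 + ?b\<^sup>2" by linarith
  thus "norm (hardy_coeff f n * cnj (hardy_coeff g n)) \<le> ?a\<^sup>2 + ?b\<^sup>2"
    by (simp add: norm_mult)
qed

lemma hinner_add_left: "hinner (f + g) h = hinner f h + hinner g h"
  unfolding hinner_def
  by (subst suminf_add[OF hinner_summable hinner_summable]) (simp add: algebra_simps)

lemma hinner_hscale_left: "hinner (hscale c f) g = c * hinner f g"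
  unfolding hinner_def
  by (subst suminf_mult[OF hinner_summable, symmetric]) (simp add: algebra_simps)

lemma hinner_commute: "hinner f g = cnj (hinner g f)"
proof -
  have "(\<lambda>n. cnj (hardy_coeff g n * cnj (hardy_coeff f n))) sums cnj (hinner g f)"
    using summable_sums[OF hinner_summable[of g f]] unfolding sums_cnj hinner_def .
  thus ?thesis by (simp add: hinner_def sums_iff mult.commute)
qed

lemma hinner_self: "hinner f f = complex_of_real (\<Sum>n. (cmod (hardy_coeff f n))\<^sup>2)"
  unfolding hinner_def
  by (subst suminf_of_real[OF hardy_coeff_square_summable]) (simp only: complex_norm_square)

text \<open>
  The distribution has no class of complex inner product spaces.  The real inner product
  \<open>Re \<langle>f, g\<rangle>\<close> induces the same norm as \<open>\<langle>f, g\<rangle>\<close>, and therefore \<open>norm\<close>, \<open>closed\<close> etc. on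
  \<open>hardy\<close> have their usual meaning in \<open>H\<^sup>2\<close>.
\<close>

instantiation hardy :: real_vector
begin

definition scaleR_hardy :: "real \<Rightarrow> hardy \<Rightarrow> hardy" where
  "scaleR_hardy r f = hscale (complex_of_real r) f"

instance
  by standard (simp_all add: scaleR_hardy_def hardy.scale_right_distrib hardy.scale_left_distrib)

end

instantiation hardy :: real_inner
begin

definition inner_hardy :: "hardy \<Rightarrow> hardy \<Rightarrow> real" where
  "inner_hardy f g = Re (hinner f g)"

definition norm_hardy :: "hardy \<Rightarrow> real" where
  "norm_hardy f = sqrt (inner f f)"

definition sgn_hardy :: "hardy \<Rightarrow> hardy" where
  "sgn_hardy f = f /\<^sub>R norm f"

definition dist_hardy :: "hardy \<Rightarrow> hardy \<Rightarrow> real" where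
  "dist_hardy f g = norm (f - g)"

definition uniformity_hardy :: "(hardy \<times> hardy) filter" where
  "uniformity_hardy = (INF e\<in>{0<..}. principal {(f, g). dist f g < e})"

definition open_hardy :: "hardy set \<Rightarrow> bool" where
  "open_hardy U \<longleftrightarrow> (\<forall>f\<in>U. eventually (\<lambda>(f', g). f' = f \<longrightarrow> g \<in> U) uniformity)"

instance
proof
  fix a :: real and f g h :: hardy
  show "sgn f = f /\<^sub>R norm f"
    by (rule sgn_hardy_def)
  show "dist f g = norm (f - g)"
    by (rule dist_hardy_def)
  show "(uniformity :: (hardy \<times> hardy) filter) = (INF e\<in>{0<..}. principal {(f, g). dist f g < e})"
    by (rule uniformity_hardy_def)
  show "open U \<longleftrightarrow> (\<forall>f\<in>U. eventually (\<lambda>(f', g). f' = f \<longrightarrow> g \<in> U) uniformity)" for U :: "hardy set"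
    by (rule open_hardy_def)
  show "inner f g = inner g f"
    unfolding inner_hardy_def by (subst hinner_commute) simp
  show "inner (f + g) h = inner f h + inner g h"
    by (simp add: inner_hardy_def hinner_add_left)
  show "inner (a *\<^sub>R f) g = a * inner f g"
    by (simp add: inner_hardy_def scaleR_hardy_def hinner_hscale_left)
  show "0 \<le> inner f f"
    by (simp add: inner_hardy_def hinner_self suminf_nonneg hardy_coeff_square_summable)
  show "inner f f = 0 \<longleftrightarrow> f = 0"
  proof
    assume "inner f f = 0"
    hence "(\<Sum>n. (cmod (hardy_coeff f n))\<^sup>2) = 0"
      by (simp add: inner_hardy_def hinner_self)
    hence "\<forall>n. (cmod (hardy_coeff f n))\<^sup>2 = 0"
      by (subst (asm) suminf_eq_zero_iff) (auto simp: hardy_coeff_square_summable)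
    thus "f = 0" by (intro hardy_eq_zeroI) simp
  qed (simp add: inner_hardy_def hinner_def)
  show "norm f = sqrt (inner f f)"
    by (rule norm_hardy_def)
qed

end


section \<open>Conjugations, invariant subspaces and their orthogonal complements\<close>

definition antilinear :: "(hardy \<Rightarrow> hardy) \<Rightarrow> bool" where
  "antilinear C \<longleftrightarrow>
     (\<forall>f g. C (f + g) = C f + C g) \<and> (\<forall>c f. C (hscale c f) = hscale (cnj c) (C f))"

definition conjugation :: "(hardy \<Rightarrow> hardy) \<Rightarrow> bool" where
  "conjugation C \<longleftrightarrow>
     antilinear C \<and> (\<forall>f g. hinner (C f) (C g) = hinner g f) \<and> (\<forall>h. C (C h) = h)"

definition hcomplement :: "hardy set \<Rightarrow> hardy set" where
  "hcomplement M = {f. \<forall>g\<in>M. hinner f g = 0}"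

definition infinite_dim :: "hardy set \<Rightarrow> bool" where
  "infinite_dim M \<longleftrightarrow> \<not> (\<exists>B. finite B \<and> hspan B = M)"

definition invariant_subspaces :: "hardy set set" where
  "invariant_subspaces =
     {M. hsubspace M \<and> closed M \<and> shift ` M \<subseteq> M \<and> infinite_dim M \<and> infinite_dim (hcomplement M)}"

text \<open>The collection \<open>\<M>(S\<^sup>*)\<close> of infinite-dimensional model spaces, by definition the
  orthogonal complements of the members of \<open>\<M>(S)\<close>.\<close>

definition coinvariant_subspaces :: "hardy set set" where
  "coinvariant_subspaces = {hcomplement M |M. M \<in> invariant_subspaces}"

end

theory Submission
  imports Defs
begin

text \<open>
  A conjugation preserves inclusions, codimensions and orthogonality, but knows nothing of \<open>S\<close>.
  So it suffices to find a property of the family \<open>\<M>(S)\<close> in these terms that \<open>\<M>(S\<^sup>*)\<close> lacks.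
  The property is the number of members of codimension one inside a given member: it is
  uncountable for every member of \<open>\<M>(S)\<close>, and countable for some member of \<open>\<M>(S\<^sup>*)\<close>.

  If \<open>M\<close> is in \<open>\<M>(S)\<close> and \<open>0 \<noteq> f \<in> M\<close>, then for every \<open>z\<close> of the disk with \<open>f z \<noteq> 0\<close> the
  subspace \<open>N\<^sub>z = {g \<in> M. g z = 0}\<close> has codimension one in \<open>M\<close> and is again in \<open>\<M>(S)\<close>
  (\<open>vanishing_part_invariant\<close>).  These \<open>z\<close> form a nonempty open set, and distinct \<open>z\<close> give
  distinct \<open>N\<^sub>z\<close>, because \<open>(S - s) f\<close> vanishes at \<open>s\<close> but not at any other \<open>t\<close> with \<open>f t \<noteq> 0\<close>.

  On the other side, let \<open>M\<^sub>0\<close> consist of the functions that vanish on a fixed sequence of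
  distinct points \<open>l\<^sub>0, l\<^sub>1, \<dots>\<close> of the disk; the sequence is chosen such that \<open>M\<^sub>0 \<noteq> 0\<close>
  (\<open>exists_hardy_zeros\<close>).  Then \<open>M\<^sub>0\<close> is in \<open>\<M>(S)\<close> and \<open>K = M\<^sub>0\<^sup>\<bottom>\<close> is in \<open>\<M>(S\<^sup>*)\<close>.
  An \<open>S\<^sup>*\<close>-invariant subspace of codimension one in \<open>K\<close>, say the set of all \<open>x \<in> K\<close> orthogonal
  to \<open>w\<close>, has the \<open>S\<close>-invariant complement \<open>M\<^sub>0 + \<complex> w\<close>.  Hence \<open>(S - a) w \<in> M\<^sub>0\<close> for some \<open>a\<close>,
  that is, \<open>(l\<^sub>n - a) w(l\<^sub>n) = 0\<close> for all \<open>n\<close>; so \<open>w\<close> is nonzero at exactly one \<open>l\<^sub>k\<close>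
  (\<open>ex1_nonzero_if_codim_one_coinvariant\<close>).  The index \<open>k\<close> determines \<open>w\<close> modulo \<open>M\<^sub>0\<close> up to
  a factor, hence the subspace, so there are only countably many of them.

  If \<open>C M = K\<close>, then \<open>C\<close> carries \<open>N\<^sub>z\<close> to the subspace of \<open>K\<close> that belongs to \<open>w = C k\<^sub>z\<close>, with
  \<open>k\<^sub>z\<close> the reproducing kernel at \<open>z\<close>, and \<open>z \<mapsto> k\<close> injects an uncountable set into \<open>\<nat>\<close>.
\<close>

section \<open>Coefficients, point evaluations and kernels\<close>

lemma hardy_fun_sums:
  assumes "norm z < 1"
  shows "(\<lambda>n. hardy_coeff f n * z ^ n) sums hardy_fun f z"
proof -
  let ?F = "fps_expansion (hardy_fun f) 0"
  have r: "fps_conv_radius ?F \<ge> 1"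
    using hardy_fun[of f] by (intro conv_radius_fps_expansion) (auto simp: hardy_set_def)
  have "eval_fps ?F z = hardy_fun f z"
    using assms hardy_fun_has_fps_expansion[of f] hardy_fun[of f]
    by (intro has_fps_expansion_imp_eval_fps_eq[where r = 1]) (auto simp: hardy_set_def)
  moreover have "(\<lambda>n. fps_nth ?F n * z ^ n) sums eval_fps ?F z"
    using assms r by (intro sums_eval_fps) (use less_le_trans[of "ereal (norm z)" 1] in auto)
  ultimately show ?thesis by (simp add: hardy_coeff_def)
qed

text \<open>Square-summable sequences are bounded, so their power series converge in the whole disk.\<close>

lemma exists_hardy_coeff:
  assumes "summable (\<lambda>n. (cmod (a n))\<^sup>2)"
  shows "\<exists>f. \<forall>n. hardy_coeff f n = a n"
proof -
  define F where "F = Abs_fps a"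
  have "Bseq (\<lambda>n. (cmod (a n))\<^sup>2)"
    by (rule convergent_imp_Bseq[OF convergentI[OF summable_LIMSEQ_zero[OF assms]]])
  then obtain B where B: "\<And>n. (cmod (a n))\<^sup>2 \<le> B" by (auto simp: Bseq_def)
  have B': "cmod (a n) \<le> sqrt B" for n
    using B[of n] by (metis real_le_rsqrt)
  have "conv_radius a \<ge> 1"
  proof (rule conv_radius_geI_ex)
    fix r :: real assume r: "0 < r" "ereal r < 1"
    have "summable (\<lambda>n. a n * complex_of_real r ^ n)"
    proof (rule summable_comparison_test')
      show "summable (\<lambda>n. sqrt B * r ^ n)"
        using r by (intro summable_mult summable_geometric) auto
      show "norm (a n * complex_of_real r ^ n) \<le> sqrt B * r ^ n" for n
        using B'[of n] r by (auto simp: norm_mult norm_power intro!: mult_right_mono)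
    qed
    thus "\<exists>z. norm z = r \<and> summable (\<lambda>n. a n * z ^ n)"
      using r by (intro exI[of _ "complex_of_real r"]) auto
  qed
  hence R: "fps_conv_radius F \<ge> 1" by (simp add: F_def fps_conv_radius_def)
  define g where "g z = (if z \<in> ball 0 1 then eval_fps F z else 0)" for z
  have "eval_fps F holomorphic_on ball 0 1"
    using R by (intro holomorphic_on_eval_fps) (use less_le_trans[of "ereal _" 1] in auto)
  hence "g holomorphic_on ball 0 1"
    by (rule holomorphic_transform) (auto simp: g_def)
  moreover have "g has_fps_expansion F"
    unfolding has_fps_expansion_def
  proof
    show "fps_conv_radius F > 0" using R by (rule less_le_trans[rotated]) simp
    have "eventually (\<lambda>z. z \<in> ball 0 1) (nhds (0::complex))"
      by (rule eventually_nhds_in_open) auto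
    thus "eventually (\<lambda>z. eval_fps F z = g z) (nhds 0)"
      by eventually_elim (simp add: g_def)
  qed
  ultimately have G: "g \<in> hardy_set"
    using assms by (intro hardy_setI[where F = F]) (auto simp: g_def square_summable_fps_def F_def)
  have "hardy_coeff (Abs_hardy g) n = a n" for n
    using \<open>g has_fps_expansion F\<close>
    by (subst hardy_coeff_eqI[where F = F]) (auto simp: Abs_hardy_inverse[OF G] F_def)
  thus ?thesis by blast
qed

text \<open>The reproducing kernel at \<open>z\<close>, that is \<open>x \<mapsto> 1 / (1 - cnj z * x)\<close>; it is given by its
  coefficients, which for \<open>norm z < 1\<close> are square-summable and then determine it.\<close>

definition kernel :: "complex \<Rightarrow> hardy" where
  "kernel z = (SOME k. \<forall>n. hardy_coeff k n = cnj z ^ n)"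

lemma hinner_kernel:
  assumes "norm z < 1"
  shows "hinner f (kernel z) = hardy_fun f z"
proof -
  have "summable (\<lambda>n. (norm z ^ 2) ^ n)"
    using assms by (intro summable_geometric) (simp add: power_less_one_iff)
  hence "\<exists>k. \<forall>n. hardy_coeff k n = cnj z ^ n"
    by (intro exists_hardy_coeff) (simp add: norm_power power_mult[symmetric] mult.commute)
  hence "\<forall>n. hardy_coeff (kernel z) n = cnj z ^ n"
    unfolding kernel_def by (rule someI_ex)
  thus ?thesis
    using hardy_fun_sums[OF assms, of f] by (simp add: hinner_def sums_iff)
qed

lemma hardy_fun_add [simp]: "hardy_fun (f + g) z = hardy_fun f z + hardy_fun g z"
  by (simp add: plus_hardy.rep_eq)

lemma hardy_fun_diff [simp]: "hardy_fun (f - g) z = hardy_fun f z - hardy_fun g z"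
  by (simp add: minus_hardy.rep_eq)

lemma hardy_fun_hscale [simp]: "hardy_fun (hscale c f) z = c * hardy_fun f z"
  by (simp add: hscale.rep_eq)

lemma hardy_fun_shift [simp]: "hardy_fun (shift f) z = z * hardy_fun f z"
  by (simp add: shift.rep_eq)

lemma hardy_fun_zero [simp]: "hardy_fun 0 z = 0"
  by (simp add: zero_hardy.rep_eq)

lemma hinner_add_right: "hinner f (g + h) = hinner f g + hinner f h"
  by (subst (1 2 3) hinner_commute) (simp add: hinner_add_left)

lemma hinner_hscale_right: "hinner f (hscale c g) = cnj c * hinner f g"
  by (subst (1 2) hinner_commute) (simp add: hinner_hscale_left)

lemma hinner_diff_left: "hinner (f - g) h = hinner f h - hinner g h"
  using hinner_add_left[of "f - g" g h] by simp

lemma hinner_zero_left [simp]: "hinner 0 g = 0"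
  by (simp add: hinner_def)

lemma hinner_sum_left: "hinner (sum f A) g = (\<Sum>a\<in>A. hinner (f a) g)"
  by (induction A rule: infinite_finite_induct) (auto simp: hinner_add_left)

lemma hinner_eq_0_commute: "hinner f g = 0 \<longleftrightarrow> hinner g f = 0"
  by (subst hinner_commute) simp

text \<open>The witness is the backward shift of \<open>g\<close>.\<close>

lemma exists_shift_adjoint: "\<exists>h. \<forall>f. hinner (shift f) g = hinner f h"
proof -
  have "summable (\<lambda>n. (cmod (hardy_coeff g (Suc n)))\<^sup>2)"
    using hardy_coeff_square_summable[of g] by (subst summable_Suc_iff)
  then obtain h where h: "\<And>n. hardy_coeff h n = hardy_coeff g (Suc n)"
    using exists_hardy_coeff[of "\<lambda>n. hardy_coeff g (Suc n)"] by blast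
  have "hinner (shift f) g = hinner f h" for f
    using suminf_split_head[OF hinner_summable[of "shift f" g]]
    by (simp add: hinner_def h hardy_coeff_shift)
  thus ?thesis by blast
qed

text \<open>The topology of \<open>hardy\<close> comes from the real inner product \<open>Re \<langle>f, g\<rangle>\<close>, which also yields the
  imaginary part, because \<open>Im \<langle>f, g\<rangle> = Re \<langle>f, \<i> g\<rangle>\<close>.\<close>

lemma continuous_on_hinner: "continuous_on UNIV (\<lambda>f. hinner f g)"
proof -
  have "hinner f g = Complex (inner f g) (inner f (hscale \<i> g))" for f
    by (simp add: inner_hardy_def hinner_hscale_right complex_eq_iff)
  thus ?thesis by (auto intro!: continuous_intros)
qed

lemma closed_hinner_zero: "closed {f. hinner f g = 0}"
  using continuous_closed_preimage_constant[OF continuous_on_hinner closed_UNIV, of g 0] by simp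

section \<open>Infinite-dimensional subspaces\<close>

lemma infinite_dim_mono:
  assumes "hsubspace A" "A \<subseteq> B" "infinite_dim A"
  shows "infinite_dim B"
  unfolding infinite_dim_def
proof
  assume "\<exists>E. finite E \<and> hspan E = B"
  then obtain E where E: "finite E" "hspan E = B" by blast
  obtain D where D: "D \<subseteq> A" "\<not> hardy.dependent D" "A \<subseteq> hspan D"
    using hardy.maximal_independent_subset[of A] by blast
  have "finite D"
    using hardy.independent_span_bound[OF E(1) D(2)] D(1) assms(2) E(2) by blast
  moreover have "hspan D = A"
    using D assms(1) hardy.span_minimal by blast
  ultimately show False using assms(3) by (auto simp: infinite_dim_def)
qed

text \<open>
  The separation hypothesis rules out linear relations: take as \<open>F\<close> the set of indices with a nonzero
  coefficient and pair the relation with \<open>y\<close>.  Letting \<open>n\<close> and \<open>y\<close> depend on \<open>F\<close> covers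
  both families that are needed: iterated shifts, which are triangular in the order of vanishing at
  0, and kernels, for which \<open>y\<close> is a polynomial that
  vanishes at all but one of the points.
\<close>

lemma infinite_dim_family:
  fixes x :: "nat \<Rightarrow> hardy"
  assumes A: "range x \<subseteq> A"
    and sep: "\<And>F. finite F \<Longrightarrow> F \<noteq> {} \<Longrightarrow>
      \<exists>n\<in>F. \<exists>y. hinner (x n) y \<noteq> 0 \<and> (\<forall>m\<in>F - {n}. hinner (x m) y = 0)"
  shows "infinite_dim A"
proof -
  have inj: "inj x"
  proof (rule injI, rule ccontr)
    fix m n assume "x m = x n" "m \<noteq> n"
    thus False using sep[of "{m, n}"] by (auto simp: insert_Diff_if)
  qed
  have "\<not> hardy.dependent (range x)"
  proof
    assume "hardy.dependent (range x)"
    then obtain T u where T: "finite T" "T \<subseteq> range x" "(\<Sum>v\<in>T. hscale (u v) v) = 0"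
      "\<exists>v\<in>T. u v \<noteq> 0"
      unfolding hardy.dependent_explicit by blast
    define F where "F = {n. x n \<in> T \<and> u (x n) \<noteq> 0}"
    have "finite F"
      using finite_vimageI[OF T(1) inj] by (rule finite_subset[rotated]) (auto simp: F_def)
    moreover have "F \<noteq> {}" using T(2,4) by (auto simp: F_def)
    ultimately have "\<exists>n\<in>F. \<exists>y. hinner (x n) y \<noteq> 0 \<and> (\<forall>m\<in>F - {n}. hinner (x m) y = 0)"
      by (rule sep)
    then obtain n y where n: "n \<in> F" "hinner (x n) y \<noteq> 0"
      "\<forall>m\<in>F - {n}. hinner (x m) y = 0"
      by (elim bexE exE conjE)
    have "hinner (hscale (u v) v) y = 0" if v: "v \<in> T - {x n}" for v
    proof -
      obtain m where m: "v = x m" using T(2) v by blast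
      show ?thesis using v n(3) by (cases "u v = 0") (auto simp: hinner_hscale_left m F_def)
    qed
    hence "hinner (\<Sum>v\<in>T. hscale (u v) v) y = hinner (hscale (u (x n)) (x n)) y"
      using T(1) n(1) by (subst hinner_sum_left, subst sum.remove[of _ "x n"]) (auto simp: F_def)
    thus False using n(1,2) T(3) by (simp add: hinner_hscale_left F_def)
  qed
  show ?thesis
    unfolding infinite_dim_def
  proof
    assume "\<exists>B. finite B \<and> hspan B = A"
    then obtain B where "finite B" "hspan B = A" by blast
    hence "finite (range x)"
      using hardy.independent_span_bound[of B "range x"] A \<open>\<not> hardy.dependent (range x)\<close> by blast
    thus False using inj by (simp add: finite_image_iff)
  qed
qed

text \<open>If \<open>f\<close> vanishes at 0 to order \<open>d\<close>, then \<open>S\<^sup>n f\<close> does so to order \<open>n + d\<close>; these orders are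
  distinct, so the iterates are linearly independent.\<close>

lemma infinite_dim_shift_invariant:
  assumes "shift ` M \<subseteq> M" "f \<in> M" "f \<noteq> 0"
  shows "infinite_dim M"
proof -
  define d where "d = (LEAST n. hardy_coeff f n \<noteq> 0)"
  have "\<exists>n. hardy_coeff f n \<noteq> 0" using assms(3) hardy_eq_zeroI by blast
  hence d: "hardy_coeff f d \<noteq> 0" "\<And>n. n < d \<Longrightarrow> hardy_coeff f n = 0"
    unfolding d_def by (rule LeastI_ex) (use not_less_Least in blast)
  have coeff: "hardy_coeff ((shift ^^ m) f) n = (if n < m then 0 else hardy_coeff f (n - m))" for m n
    by (induction m arbitrary: n) (auto simp: hardy_coeff_shift)
  show ?thesis
  proof (rule infinite_dim_family)
    have "(shift ^^ n) f \<in> M" for n using assms(1,2) by (induction n) auto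
    thus "range (\<lambda>n. (shift ^^ n) f) \<subseteq> M" by blast
  next
    fix F :: "nat set" assume F: "finite F" "F \<noteq> {}"
    \<comment> \<open>Pairing with the monomial of degree \<open>Min F + d\<close> detects only the least shift in \<open>F\<close>.\<close>
    define n where "n = Min F"
    have n: "n \<in> F" "\<And>m. m \<in> F \<Longrightarrow> n \<le> m" using F by (auto simp: n_def)
    have "summable (\<lambda>i. (cmod (if i = n + d then 1 else 0))\<^sup>2)"
      by (rule summable_finite[of "{n + d}"]) auto
    then obtain y where y: "\<And>i. hardy_coeff y i = (if i = n + d then 1 else 0)"
      using exists_hardy_coeff[of "\<lambda>i. if i = n + d then 1 else 0"] by auto
    have "hinner g y = hardy_coeff g (n + d)" for g
      unfolding hinner_def by (subst suminf_finite[of "{n + d}"]) (auto simp: y)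
    thus "\<exists>n\<in>F. \<exists>y. hinner ((shift ^^ n) f) y \<noteq> 0 \<and>
            (\<forall>m\<in>F - {n}. hinner ((shift ^^ m) f) y = 0)"
      using n d by (intro bexI[of _ n] exI[of _ y]) (force simp: coeff)+
  qed
qed

lemma exists_hardy_one: "\<exists>p. \<forall>z. norm z < 1 \<longrightarrow> hardy_fun p z = 1"
proof -
  have "summable (\<lambda>i. (cmod (if i = 0 then 1 else 0))\<^sup>2)"
    by (rule summable_finite[of "{0}"]) auto
  then obtain y where y: "\<And>i. hardy_coeff y i = (if i = 0 then 1 else 0)"
    using exists_hardy_coeff[of "\<lambda>i. if i = 0 then 1 else 0"] by auto
  have "hardy_fun y z = 1" if "norm z < 1" for z
  proof -
    have "(\<lambda>n. hardy_coeff y n * z ^ n) sums (\<Sum>n\<in>{0}. hardy_coeff y n * z ^ n)"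
      by (rule sums_finite) (auto simp: y)
    from sums_unique2[OF this hardy_fun_sums[OF that, of y]] show ?thesis by (simp add: y)
  qed
  thus ?thesis by blast
qed

lemma exists_hardy_prod:
  assumes "finite G"
  shows "\<exists>p. \<forall>z. norm z < 1 \<longrightarrow> hardy_fun p z = (\<Prod>a\<in>G. z - a)"
  using assms
proof (induction G)
  case empty
  thus ?case using exists_hardy_one by simp
next
  case (insert a G)
  then obtain p where "\<forall>z. norm z < 1 \<longrightarrow> hardy_fun p z = (\<Prod>a\<in>G. z - a)" by blast
  thus ?case using insert.hyps
    by (intro exI[of _ "shift p - hscale a p"]) (simp add: algebra_simps)
qed

lemma infinite_dim_kernels:
  fixes l :: "nat \<Rightarrow> complex"
  assumes "inj l" "\<And>n. norm (l n) < 1" "\<And>n. kernel (l n) \<in> K"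
  shows "infinite_dim K"
proof (rule infinite_dim_family)
  show "range (\<lambda>n. kernel (l n)) \<subseteq> K" using assms by blast
next
  fix F :: "nat set" assume F: "finite F" "F \<noteq> {}"
  then obtain n where n: "n \<in> F" by blast
  obtain p where p: "\<And>z. norm z < 1 \<Longrightarrow> hardy_fun p z = (\<Prod>a\<in>l ` (F - {n}). z - a)"
    using exists_hardy_prod[of "l ` (F - {n})"] F by auto
  have ip: "hinner (kernel (l m)) p = cnj (hardy_fun p (l m))" for m
    by (subst hinner_commute) (simp add: hinner_kernel assms)
  have "hardy_fun p (l n) \<noteq> 0"
    using F assms(1) by (auto simp: p assms(2) dest: injD)
  moreover have "hardy_fun p (l m) = 0" if "m \<in> F - {n}" for m
    using F that by (subst p[OF assms(2)], intro prod_zero) auto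
  ultimately show "\<exists>n\<in>F. \<exists>y. hinner (kernel (l n)) y \<noteq> 0 \<and>
            (\<forall>m\<in>F - {n}. hinner (kernel (l m)) y = 0)"
    using n by (intro bexI[of _ n] exI[of _ p]) (auto simp: ip)
qed

section \<open>A function with infinitely many zeros\<close>

text \<open>For such \<open>c\<close> one has \<open>\<bar>c - m\<bar>\<^sup>2 = (m - 1)\<^sup>2 + 1 \<le> m\<^sup>2\<close> for all \<open>m \<ge> 1\<close>, so the sequence
  \<open>m \<bar>c gchoose m\<bar>\<close> does not increase from \<open>m = 1\<close> on, where its value is \<open>\<bar>c\<bar>\<close>.\<close>

lemma norm_gbinomial_bound:
  fixes c :: complex
  assumes "Re c = 1" and im: "(Im c)\<^sup>2 = 1"
  shows "real (Suc n) * norm (c gchoose Suc n) \<le> sqrt 2"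
proof (induction n)
  case 0
  show ?case using assms(1) im by (simp add: cmod_def)
next
  case (Suc n)
  have rec: "of_nat (Suc (Suc n)) * (c gchoose Suc (Suc n)) = (c gchoose Suc n) * (c - of_nat (Suc n))"
    using gbinomial_mult_1[of c "Suc n"] by (simp add: algebra_simps)
  have "norm (c - of_nat (Suc n)) = sqrt (real n ^ 2 + 1)"
    using assms(1) im by (simp add: cmod_def)
  also have "\<dots> \<le> sqrt ((real (Suc n))\<^sup>2)"
    by (rule real_sqrt_le_mono) (simp add: power2_eq_square algebra_simps)
  finally have le: "norm (c - of_nat (Suc n)) \<le> real (Suc n)" by simp
  have "real (Suc (Suc n)) * norm (c gchoose Suc (Suc n)) =
        norm (of_nat (Suc (Suc n)) * (c gchoose Suc (Suc n)))"
    by (simp only: norm_mult norm_of_nat)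
  also have "\<dots> = norm (c gchoose Suc n) * norm (c - of_nat (Suc n))"
    by (simp only: rec norm_mult)
  also have "\<dots> \<le> norm (c gchoose Suc n) * real (Suc n)"
    using le by (rule mult_left_mono) simp
  finally show ?case using Suc by (simp add: mult.commute)
qed

lemma square_summable_gbinomial:
  fixes c :: complex
  assumes "Re c = 1" "(Im c)\<^sup>2 = 1"
  shows "summable (\<lambda>n. (cmod (c gchoose n))\<^sup>2)"
proof (subst summable_Suc_iff[symmetric], rule summable_comparison_test')
  show "summable (\<lambda>n. 2 * inverse (real (Suc n) ^ 2))"
    using inverse_power_summable[of 2, where ?'a = real]
    by (intro summable_mult) (subst summable_Suc_iff, simp)
next
  fix n
  have "(real (Suc n) * norm (c gchoose Suc n))\<^sup>2 \<le> (sqrt 2)\<^sup>2"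
    by (intro power_mono norm_gbinomial_bound assms) simp
  thus "norm ((cmod (c gchoose Suc n))\<^sup>2) \<le> 2 * inverse (real (Suc n) ^ 2)"
    by (simp add: power_mult_distrib field_simps del: of_nat_Suc)
qed

text \<open>
  These are zeros of \<open>(1 + z) powr (1 + \<i>) - (1 + z) powr (1 - \<i>) = 2 \<i> (1 + z) sin (ln (1 + z))\<close>, as
  \<open>ln (1 + z)\<close> takes there the values \<open>- \<pi> (n + 1)\<close>.  The coefficients of this function are
  binomial, and the factor \<open>1 + z\<close> gives the exponents the real part 1 of the preceding estimates.
\<close>

definition zeros :: "nat \<Rightarrow> complex" where
  "zeros n = complex_of_real (exp (- pi * real (Suc n)) - 1)"

lemma norm_zeros: "norm (zeros n) < 1"
proof -
  have "exp (- pi * real (Suc n)) < 1" "exp (- pi * real (Suc n)) > 0" 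
    by (auto simp del: of_nat_Suc)
  thus ?thesis unfolding zeros_def norm_of_real by (auto simp del: of_nat_Suc)
qed

lemma inj_zeros: "inj zeros"
  by (rule injI) (simp add: zeros_def del: of_real_diff of_real_exp of_real_minus of_real_mult)

lemma exists_hardy_zeros:
  obtains h where "h \<noteq> 0" "\<And>n. hardy_fun h (zeros n) = 0"
proof -
  define a where "a n = ((1 + \<i>) gchoose n) - ((1 - \<i>) gchoose n)" for n
  have "square_summable_fps (Abs_fps (\<lambda>n. (1 + \<i>) gchoose n) + 
          fps_const (-1) * Abs_fps (\<lambda>n. (1 - \<i>) gchoose n))"
    by (intro square_summable_fps_add square_summable_fps_cmult)
       (auto simp: square_summable_fps_def intro!: square_summable_gbinomial)
  hence "summable (\<lambda>n. (cmod (a n))\<^sup>2)"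
    by (simp add: square_summable_fps_def a_def)
  then obtain h where h: "\<And>n. hardy_coeff h n = a n" using exists_hardy_coeff by blast
  \<comment> \<open>The linear coefficient is \<open>(1 + \<i>) - (1 - \<i>) = 2 \<i>\<close>.\<close>
  have "h \<noteq> 0" using h[of 1] by (auto simp: a_def complex_eq_iff)
  moreover have "hardy_fun h (zeros n) = 0" for n
  proof -
    let ?t = "- pi * real (Suc n)"
    have pw: "(1 + zeros n) powr c = exp (c * of_real ?t)" for c
    proof -
      have "1 + zeros n = of_real (exp ?t)" by (simp add: zeros_def)
      moreover have "Ln (of_real (exp ?t)) = of_real ?t" by (subst Ln_of_real) auto
      moreover have "complex_of_real (exp ?t) \<noteq> 0" by (simp del: of_nat_Suc)
      ultimately show ?thesis by (simp only: powr_def if_False)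
    qed
    have "(\<lambda>k. a k * zeros n ^ k) sums ((1 + zeros n) powr (1 + \<i>) - (1 + zeros n) powr (1 - \<i>))"
      using sums_diff[OF gen_binomial_complex gen_binomial_complex, OF norm_zeros norm_zeros]
      by (simp add: a_def left_diff_distrib)
    hence "hardy_fun h (zeros n) = (1 + zeros n) powr (1 + \<i>) - (1 + zeros n) powr (1 - \<i>)"
      using hardy_fun_sums[OF norm_zeros, of h] by (simp add: h sums_iff)
    also have "\<dots> = 0"
    proof -
      have "exp ((1 + \<i>) * of_real ?t) = exp ((1 - \<i>) * of_real ?t)"
        unfolding exp_eq
        by (rule exI[of _ "- int (Suc n)"]) (simp add: algebra_simps)
      thus ?thesis by (simp only: pw) simp
    qed
    finally show ?thesis .
  qed
  ultimately show thesis using that by blast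
qed

section \<open>Invariant subspaces defined by zeros\<close>

lemma hsubspace_hcomplement: "hsubspace (hcomplement M)"
  by (rule hardy.subspaceI) (auto simp: hcomplement_def hinner_add_left hinner_hscale_left)

text \<open>The complement is infinite-dimensional because it contains the kernels at all the zeros.\<close>

lemma zero_subspace_invariant:
  "{f. \<forall>n. hardy_fun f (zeros n) = 0} \<in> invariant_subspaces" (is "?M \<in> _")
proof -
  have "hsubspace ?M" by (rule hardy.subspaceI) auto
  moreover have "?M = (\<Inter>n. {f. hinner f (kernel (zeros n)) = 0})"
    by (auto simp: hinner_kernel norm_zeros)
  hence "closed ?M" using closed_hinner_zero by auto
  moreover have sh: "shift ` ?M \<subseteq> ?M" by auto
  moreover have "infinite_dim ?M"
    using exists_hardy_zeros infinite_dim_shift_invariant[OF sh] by blast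
  moreover have "infinite_dim (hcomplement ?M)"
    by (rule infinite_dim_kernels[OF inj_zeros norm_zeros])
       (auto simp: hcomplement_def hinner_eq_0_commute[of "kernel _"] hinner_kernel norm_zeros)
  ultimately show ?thesis by (simp add: invariant_subspaces_def)
qed

text \<open>By shift invariance, \<open>{g \<in> M. g z = 0}\<close> is infinite-dimensional as soon as it is nonzero, and
  it contains \<open>(S - z) f\<close>.\<close>

lemma vanishing_part_invariant:
  assumes M: "M \<in> invariant_subspaces" and z: "norm z < 1" and f: "f \<in> M" "hardy_fun f z \<noteq> 0"
  shows "{g \<in> M. hardy_fun g z = 0} \<in> invariant_subspaces" (is "?N \<in> _")
proof -
  have M': "hsubspace M" "closed M" "shift ` M \<subseteq> M" "infinite_dim (hcomplement M)"
    using M by (auto simp: invariant_subspaces_def)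
  have "hsubspace ?N"
    using M'(1) by (intro hardy.subspaceI)
      (auto intro: hardy.subspace_0 hardy.subspace_add hardy.subspace_scale)
  moreover have "?N = M \<inter> {g. hinner g (kernel z) = 0}"
    by (auto simp: hinner_kernel z)
  hence "closed ?N" using M'(2) closed_hinner_zero by auto
  moreover have sh: "shift ` ?N \<subseteq> ?N" using M'(3) by auto
  moreover have "infinite_dim ?N"
  proof (rule infinite_dim_shift_invariant[OF sh])
    show "shift f - hscale z f \<in> ?N"
      using M' f by (auto intro!: hardy.subspace_diff hardy.subspace_scale)
    show "shift f - hscale z f \<noteq> 0"
    proof
      assume eq: "shift f - hscale z f = 0"
      \<comment> \<open>The shift has no eigenvectors: compare coefficients in \<open>S f = z f\<close>.\<close>
      have rec: "hardy_coeff (shift f) n = z * hardy_coeff f n" for n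
        using eq by (metis hardy_coeff_hscale eq_iff_diff_eq_0)
      have "hardy_coeff f n = 0" for n
      proof (cases "z = 0")
        case True
        thus ?thesis using rec[of "Suc n"] by (simp add: hardy_coeff_shift)
      next
        case False
        thus ?thesis
        proof (induction n)
          case 0
          thus ?case using rec[of 0] by (simp add: hardy_coeff_shift)
        next
          case (Suc n)
          thus ?case using rec[of "Suc n"] by (simp add: hardy_coeff_shift)
        qed
      qed
      thus False using f(2) hardy_eq_zeroI[of f] by simp
    qed
  qed
  moreover have "infinite_dim (hcomplement ?N)"
    using M'(4) by (rule infinite_dim_mono[OF hsubspace_hcomplement, rotated])
      (auto simp: hcomplement_def)
  ultimately show ?thesis by (simp add: invariant_subspaces_def)
qed

section \<open>Counting invariant subspaces of codimension one\<close>

text \<open>As the complement of an \<open>S\<close>-invariant \<open>Q\<close>, the subspace \<open>K\<close> is invariant under \<open>S\<^sup>*\<close>;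
  dualizing once more makes \<open>K\<^sup>\<bottom>\<close> invariant under \<open>S\<close>.\<close>

lemma coinvariant_perp_shift:
  assumes "K \<in> coinvariant_subspaces" "x \<in> hcomplement K"
  shows "shift x \<in> hcomplement K"
proof -
  obtain Q where Q: "K = hcomplement Q" "shift ` Q \<subseteq> Q"
    using assms(1) by (auto simp: coinvariant_subspaces_def invariant_subspaces_def)
  have "hinner (shift x) y = 0" if y: "y \<in> K" for y
  proof -
    obtain h where h: "\<And>f. hinner (shift f) y = hinner f h"
      using exists_shift_adjoint by blast
    have "hinner q h = 0" if "q \<in> Q" for q
      using Q(2) y that hinner_eq_0_commute[of "shift q" y] 
      unfolding h[symmetric] Q(1) hcomplement_def by auto
    hence "h \<in> K" by (auto simp: Q(1) hcomplement_def hinner_eq_0_commute[of h])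
    thus ?thesis using assms(2) by (auto simp: h hcomplement_def)
  qed
  thus ?thesis by (simp add: hcomplement_def)
qed

text \<open>
  Let \<open>K = M\<^sup>\<bottom>\<close> and \<open>K' = {x \<in> K. x \<bottom> w}\<close>, a proper subspace of \<open>K\<close> since it omits \<open>u\<close>.
  The vector \<open>v = (S - a) w\<close> is orthogonal to \<open>K'\<close>, and \<open>a\<close> is chosen to make it orthogonal to
  \<open>u\<close> too, hence to \<open>K = K' + \<complex> u\<close>.  As \<open>K\<close> contains the kernels at the points \<open>l n\<close>,
  \<open>v\<close> vanishes there, and \<open>w\<close> can be nonzero only at a point equal to \<open>a\<close>.  It is nonzero
  at some \<open>l n\<close>, as otherwise \<open>w \<in> M\<close> would be orthogonal to \<open>u\<close>.
\<close>

lemma ex1_nonzero_if_codim_one_coinvariant: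
  fixes l :: "nat \<Rightarrow> complex"
  defines "M \<equiv> {f. \<forall>n. hardy_fun f (l n) = 0}"
  assumes l: "inj l" "\<And>n. norm (l n) < 1"
    and co: "{x \<in> hcomplement M. hinner x w = 0} \<in> coinvariant_subspaces"
    and u: "u \<in> hcomplement M" "hinner u w \<noteq> 0"
  shows "\<exists>!k. hardy_fun w (l k) \<noteq> 0"
proof -
  let ?K' = "{x \<in> hcomplement M. hinner x w = 0}"
  have wu: "hinner w u \<noteq> 0" using u(2) hinner_eq_0_commute by blast
  have w: "w \<in> hcomplement ?K'"
    by (simp add: hcomplement_def hinner_eq_0_commute[of w])
  hence sw: "shift w \<in> hcomplement ?K'" by (rule coinvariant_perp_shift[OF co])
  define a where "a = hinner (shift w) u / hinner w u"
  define v where "v = shift w - hscale a w"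
  have "v \<in> hcomplement ?K'"
    unfolding v_def
    by (intro hardy.subspace_diff hardy.subspace_scale hsubspace_hcomplement w sw)
  have vu: "hinner v u = 0"
    using wu by (simp add: v_def a_def hinner_diff_left hinner_hscale_left)
  have perp: "hinner v x = 0" if x: "x \<in> hcomplement M" for x
  proof -
    define c where "c = hinner x w / hinner u w"
    have "x - hscale c u \<in> ?K'"
      using u(2) by (auto intro!: hardy.subspace_diff hardy.subspace_scale hsubspace_hcomplement x u(1)
        simp: hinner_diff_left hinner_hscale_left c_def)
    hence "hinner v (x - hscale c u) = 0"
      using \<open>v \<in> hcomplement ?K'\<close> unfolding hcomplement_def by blast
    hence "hinner v (x - hscale c u) + hinner v (hscale c u) = 0"
      by (simp add: hinner_hscale_right vu)
    thus ?thesis by (simp add: hinner_add_right[symmetric])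
  qed
  have ker: "kernel (l n) \<in> hcomplement M" for n
    by (simp add: hcomplement_def M_def hinner_eq_0_commute[of "kernel _"] hinner_kernel l(2))
  have z: "(l n - a) * hardy_fun w (l n) = 0" for n
    using perp[OF ker[of n]] by (simp add: hinner_kernel l(2) v_def algebra_simps)
  have "w \<notin> M" using u by (auto simp: hcomplement_def)
  then obtain k where k: "hardy_fun w (l k) \<noteq> 0" by (auto simp: M_def)
  moreover have "k' = k" if "hardy_fun w (l k') \<noteq> 0" for k'
    using that k z[of k] z[of k'] l(1) by (auto dest: injD)
  ultimately show ?thesis by blast
qed

theorem theorem3p3:
  shows "\<not> (\<exists>C. conjugation C \<and> {C ` M |M. M \<in> invariant_subspaces} = coinvariant_subspaces)"
proof
  assume "\<exists>C. conjugation C \<and> {C ` M |M. M \<in> invariant_subspaces} = coinvariant_subspaces"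
  then obtain C where "conjugation C"
    and eq: "{C ` M |M. M \<in> invariant_subspaces} = coinvariant_subspaces" by blast
  hence iso: "\<And>f g. hinner (C f) (C g) = hinner g f" by (simp add: conjugation_def)
  define M0 where "M0 = {f. \<forall>n. hardy_fun f (zeros n) = 0}"
  have "hcomplement M0 \<in> coinvariant_subspaces"
    using zero_subspace_invariant by (auto simp: coinvariant_subspaces_def M0_def)
  then obtain M where M: "M \<in> invariant_subspaces" "C ` M = hcomplement M0"
    unfolding eq[symmetric] by auto
  have sub: "hsubspace M" "shift ` M \<subseteq> M" "infinite_dim M"
    using M(1) by (auto simp: invariant_subspaces_def)
  have "M \<noteq> {0}"
    using sub(3) hardy.span_empty by (auto simp: infinite_dim_def)
  moreover have "0 \<in> M" using sub(1) by (rule hardy.subspace_0)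
  ultimately obtain f where f: "f \<in> M" "f \<noteq> 0" by blast
  define U where "U = {z \<in> ball 0 1. hardy_fun f z \<noteq> 0}"
  define w where "w z = C (kernel z)" for z
  have w: "hinner (C g) (w z) = 0 \<longleftrightarrow> hardy_fun g z = 0" if "z \<in> U" for g z
    using that unfolding w_def iso
    by (subst hinner_eq_0_commute) (simp add: hinner_kernel U_def)
  have ex1: "\<exists>!k. hardy_fun (w z) (zeros k) \<noteq> 0" if z: "z \<in> U" for z
  proof (rule ex1_nonzero_if_codim_one_coinvariant[OF inj_zeros norm_zeros])
    have "{x \<in> hcomplement M0. hinner x (w z) = 0} = C ` {g \<in> M. hardy_fun g z = 0}"
      unfolding M(2)[symmetric] using w[OF z] by auto
    also have "\<dots> \<in> coinvariant_subspaces"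
      unfolding eq[symmetric] using vanishing_part_invariant[OF M(1), of z f] f z
      by (auto simp: U_def)
    finally show "{x \<in> hcomplement {f. \<forall>n. hardy_fun f (zeros n) = 0}. hinner x (w z) = 0}
                    \<in> coinvariant_subspaces" by (simp add: M0_def)
    show "C f \<in> hcomplement {f. \<forall>n. hardy_fun f (zeros n) = 0}"
      using M(2) f(1) by (auto simp: M0_def)
    show "hinner (C f) (w z) \<noteq> 0" using w[OF z] z by (simp add: U_def)
  qed
  define k where "k z = (THE k. hardy_fun (w z) (zeros k) \<noteq> 0)" for z
  have k: "hardy_fun (w z) (zeros n) \<noteq> 0 \<longleftrightarrow> n = k z" if "z \<in> U" for z n
    using theI'[OF ex1[OF that]] ex1[OF that] unfolding k_def by blast
  have "inj_on k U"
  proof (rule inj_onI)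
    fix s t assume st: "s \<in> U" "t \<in> U" "k s = k t"
    \<comment> \<open>Both \<open>w s\<close> and \<open>w t\<close> are nonzero at the same single point of the sequence, so they are proportional modulo
      \<open>M0\<close> and cut out the same subspace of \<open>C ` M\<close>.\<close>
    define c where "c = hardy_fun (w t) (zeros (k s)) / hardy_fun (w s) (zeros (k s))"
    have c: "c \<noteq> 0" "hardy_fun (w s) (zeros (k s)) \<noteq> 0" 
      using k[OF st(1), of "k s"] k[OF st(2), of "k s"] st(3) by (auto simp: c_def)
    have "hardy_fun (w t - hscale c (w s)) (zeros n) = 0" for n
      using k[OF st(1), of n] k[OF st(2), of n] st(3) c(2)
      by (cases "n = k s") (auto simp: c_def)
    hence "w t - hscale c (w s) \<in> M0" by (simp add: M0_def)
    hence perp: "hinner x (w t - hscale c (w s)) = 0" if "x \<in> hcomplement M0" for x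
      using that by (auto simp: hcomplement_def)
    have multiple: "hinner x (w t) = cnj c * hinner x (w s)" if "x \<in> hcomplement M0" for x
      using perp[OF that] hinner_add_right[of x "w t - hscale c (w s)" "hscale c (w s)"]
      by (simp add: hinner_hscale_right)
    have same: "hardy_fun g t = 0 \<longleftrightarrow> hardy_fun g s = 0" if "g \<in> M" for g
    proof -
      have "C g \<in> hcomplement M0" using M(2) that by blast
      from multiple[OF this] show ?thesis
        using c(1) w[OF st(1), of g] w[OF st(2), of g] by auto
    qed
    \<comment> \<open>The function \<open>(S - s) f\<close> tells \<open>s\<close> and \<open>t\<close> apart.\<close>
    have "shift f - hscale s f \<in> M"
      using sub f by (auto intro!: hardy.subspace_diff hardy.subspace_scale)
    from same[OF this] have "(t - s) * hardy_fun f t = 0" by (simp add: algebra_simps)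
    thus "s = t" using st(2) by (simp add: U_def)
  qed
  hence "countable U" by (rule countableI)
  moreover have "open U"
  proof -
    have "continuous_on (ball 0 1) (hardy_fun f)"
      using hardy_fun[of f] by (auto simp: hardy_set_def intro: holomorphic_on_imp_continuous_on)
    from continuous_open_preimage[OF this, of "- {0}"]
    have "open (ball 0 1 \<inter> hardy_fun f -` (- {0}))" by (auto simp: open_Compl)
    moreover have "ball 0 1 \<inter> hardy_fun f -` (- {0}) = U" by (auto simp: U_def)
    ultimately show ?thesis by simp
  qed
  moreover have "U \<noteq> {}"
  proof
    assume "U = {}"
    hence "hardy_fun f z = hardy_fun 0 z" for z
      using hardy_fun[of f] by (cases "z \<in> ball 0 1") (auto simp: U_def hardy_set_def)
    hence "f = 0" by (simp add: hardy_fun_inject[symmetric] fun_eq_iff)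
    thus False using f(2) by simp
  qed
  then obtain z where "z \<in> U" by blast
  ultimately obtain r where "r > 0" "ball z r \<subseteq> U" using openE by blast
  with \<open>countable U\<close> show False using uncountable_ball countable_subset by blast
qed

end
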